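(* Let $p=2$, $m=4$, and $n=8$. Then the pole placement map $\chi$ is not generically surjective over $\mathbb{R}$; that is, the set of triples $(A,B,C)$ of real matrices of sizes $8\times 8$, $8\times 4$, $2\times 8$ for which the map $$\chi_{(A,B,C)}:\ \mathbb{R}^{8}\longrightarrow\mathbb{R}^{8},\qquad K\longmapsto\det(sI-A-BKC)$$ is surjective is not a generic subset of the space of all such triples.
   Context: In the map $\chi_{(A,B,C)}$, the source $\mathbb{R}^{mp}=\mathbb{R}^8$ is the space of real $4\times 2$ matrices $K$, and the target $\mathbb{R}^n=\mathbb{R}^8$ is identified with the set of monic real polynomials $s^8+a_7s^7+\cdots+a_0$ of degree $8$. Systems $(A,B,C)$ of sizes $n\times n$, $n\times m$, $p\times n$ form the vector space $V=\mathbb{R}^{n(n+m+p)}$. A subset $G\subset V$ is generic if some non-trivial (not identically zero) polynomial on $V$ vanishes on the complement $V\setminus G$. The map $\chi$ is called generically surjective over $\mathbb{R}$ if $\chi_{(A,B,C)}$ is surjective for a generic set of systems. *)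

theory Defs
  imports "HOL-Analysis.Analysis" "HOL-Computational_Algebra.Polynomial"
begin

(* det is taken over the commutative ring of real polynomials; [:0, 1:] is the indeterminate s,
   so that mat [:0, 1:] is sI. *)
definition char_polynomial :: "real^'n^'n \<Rightarrow> real poly" where
  "char_polynomial M = det (mat [:0, 1:] - (\<chi> i j. [:M $ i $ j:]))"

(* The library writes an r x c matrix as real^'c^'r: here A is n x n, B is n x m, C is p x n
   and K is m x p. *)
definition pole_placement ::
  "real^'n^'n \<Rightarrow> real^'m^'n \<Rightarrow> real^'n^'p \<Rightarrow> real^'p^'m \<Rightarrow> real poly" where
  "pole_placement A B C K = char_polynomial (A + B ** K ** C)"

definition monic_polys :: "nat \<Rightarrow> real poly set" where
  "monic_polys d = {q. degree q = d \<and> lead_coeff q = 1}"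

(* real_polynomial_function consists of the functions generated from linear forms and constants
   by sums and products, i.e. the polynomials in the coordinates of V; over the reals,
   a polynomial is the zero polynomial iff it is the zero function. *)
definition generic :: "'v::euclidean_space set \<Rightarrow> bool" where
  "generic G \<longleftrightarrow>
     (\<exists>f. real_polynomial_function f \<and> (\<exists>x. f x \<noteq> 0) \<and> (\<forall>x. x \<notin> G \<longrightarrow> f x = 0))"

lemma char_polynomial_monic: "char_polynomial (M :: real^'n^'n) \<in> monic_polys CARD('n)"
proof -
  define N where "N = mat [:0, 1:] - (\<chi> i j. [:M $ i $ j:])"
  define t where "t p = of_int (sign p) * (\<Prod>i\<in>(UNIV::'n set). N $ i $ p i)" for p
  let ?P = "{p. p permutes (UNIV :: 'n set)}"
  have nd: "N $ i $ i = [:- M $ i $ i, 1:]" for i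
    by (simp add: N_def mat_def)
  have no: "N $ i $ j = [:- M $ i $ j:]" if "i \<noteq> j" for i j
    using that by (simp add: N_def mat_def)
  have fin: "finite ?P" by (simp add: finite_permutations)
  have eq: "char_polynomial M = t id + sum t (?P - {id})"
  proof -
    have "char_polynomial M = sum t ?P"
      by (simp add: char_polynomial_def det_def t_def N_def)
    also have "\<dots> = t id + sum t (?P - {id})"
      by (rule sum.remove[OF fin]) (simp add: permutes_id)
    finally show ?thesis .
  qed
  have tid: "t id = (\<Prod>i\<in>(UNIV::'n set). [:- M $ i $ i, 1:])"
    by (simp add: t_def nd)
  have deg_id: "degree (t id) = CARD('n)"
    unfolding tid by (subst degree_prod_eq_sum_degree) auto
  have lc_id: "lead_coeff (t id) = 1"
    unfolding tid by (simp add: lead_coeff_prod)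
  have small: "degree (t p) < CARD('n)" if "p \<in> ?P - {id}" for p
  proof -
    have "p \<noteq> id" using that by simp
    then obtain k where k: "p k \<noteq> k" by (metis eq_id_iff)
    have "degree (t p) \<le> degree (\<Prod>i\<in>(UNIV::'n set). N $ i $ p i)"
      by (simp add: t_def sign_def)
    also have "\<dots> \<le> (\<Sum>i\<in>(UNIV::'n set). degree (N $ i $ p i))"
      by (rule degree_prod_sum_le[unfolded o_def]) simp
    also have "\<dots> < (\<Sum>i\<in>(UNIV::'n set). 1)"
    proof (rule sum_strict_mono_ex1)
      show "\<forall>i\<in>UNIV. degree (N $ i $ p i) \<le> 1"
      proof
        fix i show "degree (N $ i $ p i) \<le> 1"
          by (cases "p i = i") (simp_all add: nd no)
      qed
      show "\<exists>i\<in>UNIV. degree (N $ i $ p i) < 1"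
        using k no[of k "p k"] by (intro bexI[of _ k]) auto
    qed simp
    finally show ?thesis by simp
  qed
  have "degree (sum t (?P - {id})) < CARD('n)"
    by (rule degree_sum_less) (auto intro: small)
  with deg_id lc_id show ?thesis
    unfolding monic_polys_def eq by (simp add: degree_add_eq_left lead_coeff_add_le coeff_eq_0)
qed

lemma pole_placement_monic:
  fixes A :: "real^'n^'n"
  shows "pole_placement A B C K \<in> monic_polys CARD('n)"
  by (simp add: pole_placement_def char_polynomial_monic)

end

theory Submission imports Defs begin

text \<open>For real \<open>s\<close>, a real gain \<open>K\<close> enters \<open>det (sI - A - BKC)\<close> only through the graph of \<open>K\<close>, a real
  2-plane in \<open>\<real>\<^sup>2 \<times> \<real>\<^sup>4 = \<complex>\<^sup>3\<close> with basis \<open>u, v\<close>. For the system \<open>(A0, B0, C0)\<close> chosen below, with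
  \<open>w = (s - \<i>) / (s + \<i>)\<close> on the unit circle,
  \<open>det (sI - A - BKC) = (s\<^sup>2 + 1)^4 Im (cnj (Z u w) * Z v w)\<close>, where
  \<open>Z u w = u3 + 2 w u2 + 2 w\<^sup>2 u1 - w\<^sup>3 cnj u1 + w^4 cnj u2\<close>.
  The target polynomial \<open>(s\<^sup>2 + 1)\<^sup>3 (s\<^sup>2 - 1)\<close> is \<open>(s\<^sup>2 + 1)^4 Re w\<close>, which has frequency 1 only.
  Vanishing of the Fourier coefficients of frequency 0, 2, 3 and 4 already forces \<open>u\<close> and \<open>v\<close> to be
  linearly dependent over \<open>\<real>\<close>. Since this excludes every 2-plane, including those that are not graphs,
  compactness of the Grassmannian excludes solutions for all systems in a ball around
  \<open>(A0, B0, C0)\<close>, and a polynomial that vanishes on a ball is zero.\<close>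

subsection \<open>Low-rank updates of determinants\<close>

text \<open>If \<open>x$k\<close> is nonzero, \<open>x\<close> and the unit vectors other than the
  \<open>k\<close>-th form a basis, the columns of \<open>Q\<close>. In it the map has matrix
  \<open>R\<close>, which differs from the identity only in row \<open>k\<close>.\<close>

lemma det_rank_one_update:
  fixes x y :: "real^'n"
  shows "det (mat 1 - (\<chi> i j. x$i * y$j)) = 1 - x \<bullet> y"
proof (cases "x = 0")
  case True
  have "(\<chi> i j. x$i * y$j) = 0" using True by (simp add: vec_eq_iff)
  then show ?thesis using True by simp
next
  case False
  then obtain k where k: "x$k \<noteq> 0" by (auto simp: vec_eq_iff)
  define Q :: "real^'n^'n" where "Q = (\<chi> i j. if j = k then x$i else if i = j then 1 else 0)"
  define r :: "real^'n" where "r = (\<chi> j. if j = k then 1 - x \<bullet> y else - y$j)"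
  define R :: "real^'n^'n" where "R = (\<chi> i. if i = k then r else axis i 1)"
  have axis: "axis i 1 $ j = (if i = j then 1 else 0::real)" for i j :: 'n
    by (simp add: axis_def)
  have Qeq: "Q = (\<chi> i j. if j = k then x$i else mat 1$i$j)"
    by (simp add: Q_def mat_def vec_eq_iff)
  have "det Q = x$k"
    using cramer_lemma[of k "mat 1 :: real^'n^'n" x] unfolding matrix_vector_mul_lid Qeq[symmetric] by simp
  have "transpose R = (\<chi> i j. if j = k then (mat 1 *v r)$i else mat 1$i$j)"
    unfolding matrix_vector_mul_lid by (auto simp: R_def transpose_def vec_eq_iff mat_def axis)
  then have "det R = r$k"
    using cramer_lemma[of k "mat 1 :: real^'n^'n" r] det_transpose[of R] by simp
  have "(mat 1 - (\<chi> i j. x$i * y$j)) ** Q = Q ** R"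
  proof -
    have "((mat 1 - (\<chi> i j. x$i * y$j)) ** Q)$i$j = (Q ** R)$i$j" for i j
    proof -
      have L: "((mat 1 - (\<chi> i j. x$i * y$j)) ** Q)$i$j = Q$i$j - x$i * (\<Sum>l\<in>UNIV. y$l * Q$l$j)"
        by (simp add: matrix_matrix_mult_def mat_def left_diff_distrib sum_subtractf sum_distrib_left
            mult.assoc if_distrib[of "\<lambda>t. t * _"] sum.delta cong: if_cong)
      have "(Q ** R)$i$j = Q$i$k * R$k$j + (\<Sum>l\<in>UNIV-{k}. Q$i$l * R$l$j)"
        by (simp add: matrix_matrix_mult_def sum.remove[of UNIV k])
      also have "(\<Sum>l\<in>UNIV-{k}. Q$i$l * R$l$j) = (\<Sum>l\<in>UNIV-{k}. if l = j then Q$i$l else 0)"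
        by (rule sum.cong) (auto simp: R_def axis)
      also have "\<dots> = (if j = k then 0 else Q$i$j)"
        by simp
      finally have RR: "(Q ** R)$i$j = x$i * r$j + (if j = k then 0 else Q$i$j)"
        by (simp add: Q_def R_def)
      show ?thesis
      proof (cases "j = k")
        case True
        then have "(\<Sum>l\<in>UNIV. y$l * Q$l$j) = x \<bullet> y"
          by (simp add: Q_def inner_vec_def mult.commute)
        with True show ?thesis unfolding L RR by (simp add: r_def Q_def algebra_simps)
      next
        case False
        then have "(\<Sum>l\<in>UNIV. y$l * Q$l$j) = (\<Sum>l\<in>UNIV. if l = j then y$l else 0)"
          by (intro sum.cong) (auto simp: Q_def)
        with False show ?thesis unfolding L RR by (simp add: r_def)
      qed
    qed
    then show ?thesis by (simp add: vec_eq_iff)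
  qed
  then have "det (mat 1 - (\<chi> i j. x$i * y$j)) * det Q = det Q * det R"
    by (metis det_mul)
  then show ?thesis using k \<open>det Q = x$k\<close> \<open>det R = r$k\<close> by (simp add: r_def)
qed

text \<open>If \<open>a \<bullet> c \<noteq> 1\<close>, the first rank-one factor is invertible and
  splits off, leaving a second rank-one update. Continuity along the multiples
  \<open>t *\<^sub>R a\<close> covers the remaining case.\<close>

lemma det_rank_two_update:
  fixes a b c d :: "real^'n"
  shows "det (mat 1 - (\<chi> i j. a$i * c$j) - (\<chi> i j. b$i * d$j)) =
    (1 - a \<bullet> c) * (1 - b \<bullet> d) - (b \<bullet> c) * (a \<bullet> d)"
proof -
  have main: "det (mat 1 - (\<chi> i j. a$i * c$j) - (\<chi> i j. b$i * d$j)) =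
    (1 - a \<bullet> c) * (1 - b \<bullet> d) - (b \<bullet> c) * (a \<bullet> d)" if ac: "a \<bullet> c \<noteq> 1" for a :: "real^'n"
  proof -
    \<comment> \<open>This is the inverse of I - a c^T applied to \<open>b\<close>
      (Sherman-Morrison); \<open>key\<close> states it.\<close>
    define e where "e = b + ((b \<bullet> c) / (1 - a \<bullet> c)) *\<^sub>R a"
    define m where "m = 1 - a \<bullet> c"
    have m: "a \<bullet> c = 1 - m" "m \<noteq> 0"
      using ac by (auto simp: m_def)
    have "c \<bullet> e = b \<bullet> c + (b \<bullet> c) / m * (1 - m)"
      unfolding e_def m_def[symmetric] by (simp add: inner_add_right inner_commute[of c] m(1))
    also have "\<dots> = (b \<bullet> c) / m"
      using m(2) by (simp add: field_simps)
    finally have key: "b$i = e$i - a$i * (c \<bullet> e)" for i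
      by (simp add: e_def m_def)
    have "mat 1 - (\<chi> i j. a$i * c$j) - (\<chi> i j. b$i * d$j) =
      (mat 1 - (\<chi> i j. a$i * c$j)) ** (mat 1 - (\<chi> i j. e$i * d$j))" (is "?L = ?R")
    proof -
      have "?L$i$j = ?R$i$j" for i j
      proof -
        have "?R$i$j = mat 1$i$j - a$i*c$j - (e$i*d$j - (\<Sum>l\<in>UNIV. a$i*c$l*(e$l*d$j)))"
          by (simp add: matrix_matrix_mult_def mat_def left_diff_distrib right_diff_distrib sum_subtractf
            if_distrib[of "\<lambda>t. t * _"] if_distrib[of "\<lambda>t. _ * t"] sum.delta cong: if_cong)
        moreover have "(\<Sum>l\<in>UNIV. a$i*c$l*(e$l*d$j)) = a$i * (c \<bullet> e) * d$j"
          by (simp add: inner_vec_def sum_distrib_left sum_distrib_right mult_ac)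
        ultimately show ?thesis by (simp add: key[of i] algebra_simps)
      qed
      then show ?thesis by (simp add: vec_eq_iff)
    qed
    then have "det ?L = (1 - a \<bullet> c) * (1 - e \<bullet> d)"
      by (simp add: det_mul det_rank_one_update)
    also have "\<dots> = m * (1 - (b \<bullet> d + (b \<bullet> c) / m * (a \<bullet> d)))"
      by (simp add: e_def m_def inner_add_left)
    also have "\<dots> = (1 - a \<bullet> c) * (1 - b \<bullet> d) - (b \<bullet> c) * (a \<bullet> d)"
      unfolding m_def[symmetric] using m(2) by (simp add: field_simps)
    finally show ?thesis .
  qed
  define f where "f t = det (mat 1 - (\<chi> i j. (t *\<^sub>R a)$i * c$j) - (\<chi> i j. b$i * d$j))" for t
  define g where "g t = (1 - (t *\<^sub>R a) \<bullet> c) * (1 - b \<bullet> d) - (b \<bullet> c) * ((t *\<^sub>R a) \<bullet> d)" for t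
  have cf: "isCont f 1" "isCont g 1"
    unfolding f_def g_def det_def by (auto intro!: continuous_intros)
  have "eventually (\<lambda>t. f t = g t) (at 1)"
  proof (cases "a \<bullet> c = 1")
    case True
    then have "f t = g t" if "t \<noteq> 1" for t using main[of "t *\<^sub>R a"] that by (simp add: f_def g_def)
    then show ?thesis by (simp add: eventually_at_filter)
  next
    case False
    have "eventually (\<lambda>t. (t *\<^sub>R a) \<bullet> c \<noteq> 1) (at 1)"
      by (rule tendsto_imp_eventually_ne[of _ "a \<bullet> c"]) (auto intro!: tendsto_eq_intros simp: False)
    then show ?thesis by eventually_elim (unfold f_def g_def, rule main)
  qed
  then have "f 1 = g 1"
    using cf by (metis (mono_tags, lifting) LIM_unique isContD filterlim_cong)
  then show ?thesis by (simp add: f_def g_def)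
qed

text \<open>With c1, c2 the rows of \<open>C\<close>, the hypotheses give BKC = M (a c1^T + b c2^T),
  so \<open>det M\<close> splits off and a rank-two update of the identity remains.\<close>

lemma det_output_feedback:
  fixes M :: "real^'n^'n" and B :: "real^'m^'n" and K :: "real^2^'m" and C :: "real^'n^2"
  assumes a: "M *v a = B *v column 1 K" and b: "M *v b = B *v column 2 K"
  shows "det (M - B ** K ** C) =
    det M * ((1 - (C *v a)$1) * (1 - (C *v b)$2) - (C *v b)$1 * (C *v a)$2)"
proof -
  let ?a = "\<chi> i j. a$i * C$1$j" and ?b = "\<chi> i j. b$i * C$2$j"
  have outer: "(M ** (\<chi> i j. x$i * y$j))$i$j = (M *v x)$i * y$j" for x y :: "real^'n" and i j
    by (simp add: matrix_matrix_mult_def matrix_vector_mult_def sum_distrib_right mult.assoc)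
  have distrib: "M ** (X - Y) = M ** X - M ** Y" for X Y :: "real^'n^'n"
    by (simp add: matrix_matrix_mult_def vec_eq_iff sum_subtractf right_diff_distrib)
  have BK: "(B ** K)$i$l = (B *v column l K)$i" for i l
    by (simp add: matrix_matrix_mult_def matrix_vector_mult_def column_def)
  have "(B ** K ** C)$i$j = (M ** ?a)$i$j + (M ** ?b)$i$j" for i j
    by (simp add: outer a b flip: BK) (simp add: matrix_matrix_mult_def[of "B ** K"] sum_2)
  then have "M - B ** K ** C = M - M ** ?a - M ** ?b"
    by (simp add: vec_eq_iff)
  also have "\<dots> = M ** (mat 1 - ?a - ?b)"
    by (simp add: distrib)
  finally show ?thesis
    by (simp add: det_mul det_rank_two_update matrix_vector_mult_def inner_vec_def mult.commute)
qed

section \<open>Evaluation of characteristic polynomials, and non-generic sets\<close>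

lemma poly_char_polynomial: "poly (char_polynomial M) s = det (mat s - M)"
proof -
  have "poly (of_int k) s = of_int k" for k :: int
    by (metis of_int_poly poly_of_int)
  then show ?thesis
    by (simp add: char_polynomial_def det_def poly_sum poly_prod mat_def if_distrib[of "\<lambda>q. poly q s"]
      cong: if_cong)
qed

lemma poly_pole_placement: "poly (pole_placement A B C K) s = det ((mat s - A) - B ** K ** C)"
  by (simp add: pole_placement_def poly_char_polynomial diff_diff_eq)

text \<open>On the line from \<open>x\<close> to a point \<open>y\<close> with
  \<open>f y \<noteq> 0\<close>, \<open>f\<close> is a polynomial in one variable with an interval
  of zeros, hence zero, against its value at parameter 1.\<close>

lemma not_generic_if_interior_compl:
  fixes G :: "'v::euclidean_space set"
  assumes "e > 0" "ball x e \<inter> G = {}"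
  shows "\<not> generic G"
proof
  assume "generic G"
  then obtain f y where f: "real_polynomial_function f" "f y \<noteq> 0" "\<And>x. x \<notin> G \<Longrightarrow> f x = 0"
    by (auto simp: generic_def)
  have "polynomial_function (\<lambda>t::real. x + t *\<^sub>R (y - x))"
    by (intro polynomial_function_add polynomial_function_const polynomial_function_bounded_linear
      bounded_linear_scaleR_left)
  from real_polynomial_function_compose[OF this f(1)]
  obtain c n where cn: "f (x + t *\<^sub>R (y - x)) = (\<Sum>i\<le>n. c i * t^i)" for t
    unfolding real_polynomial_function_iff_sum o_def by metis
  define r where "r = e / (norm (y - x) + 1)"
  have r: "r > 0" using assms(1) by (simp add: r_def add_nonneg_pos)
  have "f (x + t *\<^sub>R (y - x)) = 0" if "t \<in> {0<..<r}" for t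
  proof (rule f(3))
    have "norm (t *\<^sub>R (y - x)) \<le> t * (norm (y - x) + 1)"
      using that by (simp add: mult_left_mono)
    also have "\<dots> < r * (norm (y - x) + 1)"
      using that by (intro mult_strict_right_mono) (auto simp: add_nonneg_pos)
    also have "\<dots> = e"
      by (simp add: r_def add_nonneg_eq_0_iff)
    finally have "x + t *\<^sub>R (y - x) \<in> ball x e"
      by (simp add: dist_norm)
    with assms(2) show "x + t *\<^sub>R (y - x) \<notin> G" by blast
  qed
  then have "{0<..<r} \<subseteq> {t. (\<Sum>i\<le>n. c i * t^i) = 0}"
    by (auto simp: cn)
  then have "infinite {t. (\<Sum>i\<le>n. c i * t^i) = 0}"
    using r infinite_Ioo infinite_super by blast
  then have "\<forall>i\<le>n. c i = 0"
    using polyfun_finite_roots[of c n] by blast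
  then have "f (x + 1 *\<^sub>R (y - x)) = 0"
    by (simp only: cn) simp
  with f(2) show False by simp
qed

subsection \<open>Closed-loop equations and their limits\<close>

lemma tendsto_det:
  fixes M :: "'a \<Rightarrow> real^'n^'n"
  assumes "(M \<longlongrightarrow> L) F"
  shows "((\<lambda>x. det (M x)) \<longlongrightarrow> det L) F"
  unfolding det_def by (intro tendsto_intros assms)

lemma tendsto_matrix_vector_mult:
  fixes M :: "'a \<Rightarrow> real^'n^'m"
  assumes "(M \<longlongrightarrow> L) F" "(x \<longlongrightarrow> y) F"
  shows "((\<lambda>a. M a *v x a) \<longlongrightarrow> L *v y) F"
  unfolding matrix_vector_mult_def by (intro tendsto_intros assms)

text \<open>Cramer's formula for (sI - A)^-1 B k, from which continuity in \<open>A\<close>,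
  \<open>B\<close> and \<open>k\<close> can be read off.\<close>

definition state :: "real^'n^'n \<Rightarrow> real^'m^'n \<Rightarrow> real \<Rightarrow> real^'m \<Rightarrow> real^'n" where
  "state A B s k = (\<chi> j. det (\<chi> i l. if l = j then (B *v k)$i else (mat s - A)$i$l) / det (mat s - A))"

lemma state_eq_iff:
  assumes "det (mat s - A) \<noteq> 0"
  shows "(mat s - A) *v x = B *v k \<longleftrightarrow> x = state A B s k"
  unfolding state_def by (rule cramer[OF assms])

lemma tendsto_state:
  assumes "(A \<longlongrightarrow> A') F" "(B \<longlongrightarrow> B') F" "(k \<longlongrightarrow> k') F" and nz: "det (mat s - A') \<noteq> 0"
  shows "((\<lambda>a. state (A a) (B a) s (k a)) \<longlongrightarrow> state A' B' s k') F"
proof -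
  have "((\<lambda>a. \<chi> i l. if l = j then (B a *v k a)$i else (mat s - A a)$i$l) \<longlongrightarrow>
     (\<chi> i l. if l = j then (B' *v k')$i else (mat s - A')$i$l)) F" for j
  proof (intro tendsto_vec_lambda)
    show "((\<lambda>a. if l = j then (B a *v k a)$i else (mat s - A a)$i$l) \<longlongrightarrow>
      (if l = j then (B' *v k')$i else (mat s - A')$i$l)) F" for i l
      using assms(1-3) by (cases "l = j") (auto intro!: tendsto_intros tendsto_matrix_vector_mult)
  qed
  note num = this
  show ?thesis
    unfolding state_def
    by (intro tendsto_vec_lambda tendsto_divide tendsto_det[OF num] nz
      tendsto_det[OF tendsto_diff[OF tendsto_const assms(1)]])
qed

text \<open>For z = (y, k) this is y - G(s) k, where G(s) = C (sI - A)^-1 B is the transfer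
  function.\<close>

definition residual ::
  "real^'n^'n \<Rightarrow> real^'m^'n \<Rightarrow> real^'n^'p \<Rightarrow> real \<Rightarrow> (real^'p) \<times> (real^'m) \<Rightarrow> real^'p" where
  "residual A B C s z = fst z - C *v state A B s (snd z)"

lemma tendsto_residual:
  assumes "(A \<longlongrightarrow> A') F" "(B \<longlongrightarrow> B') F" "(C \<longlongrightarrow> C') F" "(z \<longlongrightarrow> z') F" "det (mat s - A') \<noteq> 0"
  shows "((\<lambda>a. residual (A a) (B a) (C a) s (z a)) \<longlongrightarrow> residual A' B' C' s z') F"
  unfolding residual_def using assms by (intro tendsto_intros tendsto_matrix_vector_mult tendsto_state)

lemma linear_residual:
  assumes nz: "det (mat s - A) \<noteq> 0"
  shows "linear (residual A B C s)"
proof -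
  note st = state_eq_iff[OF nz]
  have s: "(mat s - A) *v state A B s k = B *v k" for k
    using st by blast
  have "state A B s (k + k') = state A B s k + state A B s k'" for k k'
    by (subst eq_commute, subst st[symmetric]) (simp add: matrix_vector_right_distrib s)
  moreover have "state A B s (c *\<^sub>R k) = c *\<^sub>R state A B s k" for c k
    by (subst eq_commute, subst st[symmetric]) (simp add: s matrix_vector_mult_scaleR)
  ultimately show ?thesis
    by (intro linearI)
      (simp_all add: residual_def matrix_vector_right_distrib matrix_vector_mult_scaleR algebra_simps)
qed

definition cross2 :: "real^2 \<Rightarrow> real^2 \<Rightarrow> real" where
  "cross2 a b = a$1 * b$2 - a$2 * b$1"

text \<open>The determinant is det (sI - A) det (I - G(s) K), and the columns of I - G(s) K are the
  residuals of the basis (e_l, K e_l) of the graph of \<open>K\<close>.\<close>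

lemma det_eq_cross2_residual:
  fixes K :: "real^2^'m"
  assumes "det (mat s - A) \<noteq> 0"
  shows "det ((mat s - A) - B ** K ** C) =
    det (mat s - A) * cross2 (residual A B C s (axis 1 1, column 1 K)) (residual A B C s (axis 2 1, column 2 K))"
proof -
  have s: "(mat s - A) *v state A B s k = B *v k" for k
    using state_eq_iff[OF assms] by blast
  show ?thesis
    unfolding det_output_feedback[OF s s] by (simp add: cross2_def residual_def axis_def)
qed

text \<open>Gram-Schmidt on the basis (e_l, K e_l): \<open>cross2\<close> is bilinear and
  alternating, so only a factor \<open>c\<close> appears. It is at most 1 because both
  orthogonalized vectors have norm at least 1.\<close>

lemma orthonormal_residual:
  fixes K :: "real^2^'m"
  obtains u v c where "norm u = 1" "norm v = 1" "u \<bullet> v = 0" "0 \<le> c" "c \<le> 1"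
    "\<forall>s. det (mat s - A) \<noteq> 0 \<longrightarrow> det (mat s - A) * cross2 (residual A B C s u) (residual A B C s v)
       = c * poly (pole_placement A B C K) s"
proof -
  define a where "a = (axis 1 1 :: real^2, column 1 K)"
  define b where "b = (axis 2 1 :: real^2, column 2 K)"
  define t where "t = (a \<bullet> b) / (a \<bullet> a)"
  define d where "d = b - t *\<^sub>R a"
  have na: "1 \<le> norm a"
    using norm_fst_le[of "axis 1 1 :: real^2" "column 1 K"] by (simp add: a_def)
  have nd: "1 \<le> norm d"
  proof -
    have "\<bar>fst d $ 2\<bar> \<le> norm (fst d)" by (rule component_le_norm_cart)
    moreover have "fst d $ 2 = 1" by (simp add: d_def a_def b_def axis_def)
    ultimately show ?thesis using norm_fst_le[of "fst d" "snd d"] by simp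
  qed
  have "a \<noteq> 0" "d \<noteq> 0" using na nd by auto
  have "a \<bullet> d = 0"
    using \<open>a \<noteq> 0\<close> by (simp add: d_def t_def inner_diff_right)
  show ?thesis
  proof (rule that)
    let ?u = "(1 / norm a) *\<^sub>R a" and ?v = "(1 / norm d) *\<^sub>R d" and ?c = "1 / (norm a * norm d)"
    show "norm ?u = 1" "norm ?v = 1" "?u \<bullet> ?v = 0"
      using \<open>a \<noteq> 0\<close> \<open>d \<noteq> 0\<close> \<open>a \<bullet> d = 0\<close> by simp_all
    show "0 \<le> ?c" by simp
    show "?c \<le> 1" using mult_mono[OF na nd] by simp
    have "det (mat s - A) * cross2 (residual A B C s ?u) (residual A B C s ?v)
       = ?c * poly (pole_placement A B C K) s" if nz: "det (mat s - A) \<noteq> 0" for s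
    proof -
      interpret linear "residual A B C s" by (rule linear_residual[OF nz])
      have "cross2 (residual A B C s ?u) (residual A B C s ?v)
        = ?c * cross2 (residual A B C s a) (residual A B C s b)"
        by (simp add: cross2_def scale d_def diff algebra_simps diff_divide_distrib add_divide_distrib)
      then show ?thesis
        by (simp add: poly_pole_placement det_eq_cross2_residual[OF nz] a_def b_def)
    qed
    then show "\<forall>s. det (mat s - A) \<noteq> 0 \<longrightarrow> det (mat s - A) *
        cross2 (residual A B C s ?u) (residual A B C s ?v) = ?c * poly (pole_placement A B C K) s"
      by blast
  qed
qed

text \<open>Limits of orthonormal frames take care of sequences of gain matrices that escape to infinity.\<close>
lemma residual_equation_of_limit:
  fixes A :: "nat \<Rightarrow> real^'n^'n" and B :: "nat \<Rightarrow> real^'m^'n" and C :: "nat \<Rightarrow> real^'n^2"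
  assumes lim: "A \<longlonglongrightarrow> A'" "B \<longlonglongrightarrow> B'" "C \<longlonglongrightarrow> C'"
    and K: "\<And>n. pole_placement (A n) (B n) (C n) (K n) = p"
  obtains u v c where "norm u = 1" "norm v = 1" "u \<bullet> v = 0"
    "\<And>s. det (mat s - A') \<noteq> 0 \<Longrightarrow> det (mat s - A') * cross2 (residual A' B' C' s u) (residual A' B' C' s v)
       = c * poly p s"
proof -
  let ?P = "\<lambda>n (u, v, c). norm u = 1 \<and> norm v = 1 \<and> u \<bullet> v = 0 \<and> 0 \<le> c \<and> c \<le> 1 \<and>
    (\<forall>s. det (mat s - A n) \<noteq> 0 \<longrightarrow> det (mat s - A n) *
       cross2 (residual (A n) (B n) (C n) s u) (residual (A n) (B n) (C n) s v) = c * poly p s)"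
  have "\<exists>x. ?P n x" for n
  proof -
    obtain u v c where "norm u = 1" "norm v = 1" "u \<bullet> v = 0" "0 \<le> c" "c \<le> 1"
      "\<forall>s. det (mat s - A n) \<noteq> 0 \<longrightarrow> det (mat s - A n) *
         cross2 (residual (A n) (B n) (C n) s u) (residual (A n) (B n) (C n) s v)
         = c * poly (pole_placement (A n) (B n) (C n) (K n)) s"
      by (rule orthonormal_residual[where A = "A n" and B = "B n" and C = "C n" and K = "K n"])
    then show ?thesis by (intro exI[of _ "(u, v, c)"]) (simp add: K)
  qed
  then have "\<forall>n. \<exists>x. ?P n x" ..
  from choice[OF this] obtain f where "\<forall>n. ?P n (f n)" ..
  then have f: "?P n (f n)" for n ..
  \<comment> \<open>The bound on \<open>c\<close> makes \<open>S\<close> compact; the limit of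
    \<open>c\<close> may be 0 when the gains are unbounded.\<close>
  define S :: "(((real^2) \<times> (real^'m)) \<times> ((real^2) \<times> (real^'m)) \<times> real) set"
    where "S = sphere 0 1 \<times> sphere 0 1 \<times> {0..1}"
  have "compact S" unfolding S_def by (intro compact_Times) auto
  moreover have "f n \<in> S" for n
    using f[of n] by (cases "f n") (simp add: S_def)
  ultimately obtain l r where l: "l \<in> S" and r: "strict_mono r" and lr: "(f \<circ> r) \<longlonglongrightarrow> l"
    unfolding compact_def by metis
  obtain u v c where luvc: "l = (u, v, c)" by (cases l)
  define U V D where "U n = fst (f (r n))" and "V n = fst (snd (f (r n)))" and "D n = snd (snd (f (r n)))" for n
  have UVD: "U \<longlonglongrightarrow> u" "V \<longlonglongrightarrow> v" "D \<longlonglongrightarrow> c"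
    using tendsto_fst[OF lr] tendsto_fst[OF tendsto_snd[OF lr]] tendsto_snd[OF tendsto_snd[OF lr]]
    by (simp_all add: U_def[abs_def] V_def[abs_def] D_def[abs_def] o_def luvc)
  have fr: "U n \<bullet> V n = 0" "det (mat s - A (r n)) \<noteq> 0 \<Longrightarrow> det (mat s - A (r n)) *
       cross2 (residual (A (r n)) (B (r n)) (C (r n)) s (U n)) (residual (A (r n)) (B (r n)) (C (r n)) s (V n))
         = D n * poly p s" for n s
    using f[of "r n"] by (cases "f (r n)"; simp add: U_def V_def D_def)+
  have lim': "(\<lambda>n. A (r n)) \<longlonglongrightarrow> A'" "(\<lambda>n. B (r n)) \<longlonglongrightarrow> B'" "(\<lambda>n. C (r n)) \<longlonglongrightarrow> C'"
    using lim[THEN LIMSEQ_subseq_LIMSEQ, OF r] by (simp_all add: o_def)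
  show ?thesis
  proof (rule that)
    show "norm u = 1" "norm v = 1" using l by (auto simp: S_def luvc)
    have "(\<lambda>n. U n \<bullet> V n) \<longlonglongrightarrow> u \<bullet> v" by (intro tendsto_intros UVD)
    then show "u \<bullet> v = 0" by (simp add: fr(1) LIMSEQ_const_iff)
    fix s assume nz: "det (mat s - A') \<noteq> 0"
    have d: "(\<lambda>n. det (mat s - A (r n))) \<longlonglongrightarrow> det (mat s - A')"
      by (intro tendsto_det tendsto_intros lim')
    have "(\<lambda>n. det (mat s - A (r n)) * cross2 (residual (A (r n)) (B (r n)) (C (r n)) s (U n))
         (residual (A (r n)) (B (r n)) (C (r n)) s (V n)))
      \<longlonglongrightarrow> det (mat s - A') * cross2 (residual A' B' C' s u) (residual A' B' C' s v)"
      unfolding cross2_def by (intro tendsto_intros d tendsto_residual lim' UVD nz)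
    \<comment> \<open>The equation is known only where the determinant is nonzero, which holds for
      large \<open>n\<close> because its limit is nonzero.\<close>
    moreover have "eventually (\<lambda>n. det (mat s - A (r n)) * cross2 (residual (A (r n)) (B (r n)) (C (r n)) s (U n))
         (residual (A (r n)) (B (r n)) (C (r n)) s (V n)) = D n * poly p s) sequentially"
      using tendsto_imp_eventually_ne[OF d nz] by eventually_elim (rule fr(2))
    ultimately have "(\<lambda>n. D n * poly p s) \<longlonglongrightarrow> det (mat s - A') * cross2 (residual A' B' C' s u) (residual A' B' C' s v)"
      by (rule Lim_transform_eventually)
    moreover have "(\<lambda>n. D n * poly p s) \<longlonglongrightarrow> c * poly p s"
      by (intro tendsto_intros UVD)
    ultimately show "det (mat s - A') * cross2 (residual A' B' C' s u) (residual A' B' C' s v) = c * poly p s"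
      by (rule LIMSEQ_unique)
  qed
qed

subsection \<open>The Fourier coefficient equations\<close>

text \<open>The products of \<open>Z_fun\<close> and a conjugate involve only \<open>w^k\<close> with \<open>\<bar>k\<bar> \<le> 4\<close>. In the coefficients
  of the skew form, frequency 4 carries \<open>u2, u3\<close>, frequency 3 carries \<open>u1, u3\<close>, and the diagonal terms
  appear in frequency 0 with weights 1, 3, 3 of the same sign; this makes the system definite.\<close>
definition Z_fun :: "complex \<Rightarrow> complex \<Rightarrow> complex \<Rightarrow> complex \<Rightarrow> complex" where
  "Z_fun a1 a2 a3 w = a3 + 2 * w * a2 + 2 * w^2 * a1 - w^3 * cnj a1 + w^4 * cnj a2"

lemma infinite_unit_circle_minus_1: "infinite {w :: complex. norm w = 1 \<and> w \<noteq> 1}"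
proof -
  have "cis t \<noteq> 1" if "t \<in> {0<..<pi}" for t
    using that sin_gt_zero[of t] by (auto simp: complex_eq_iff)
  then have "cis ` {0<..<pi} \<subseteq> {w. norm w = 1 \<and> w \<noteq> 1}"
    by auto
  moreover have "inj_on cis {0<..<pi}"
    by (intro inj_onI) (auto simp: complex_eq_iff intro: cos_inj_pi)
  then have "infinite (cis ` {0<..<pi})"
    by (simp add: finite_image_iff infinite_Ioo)
  ultimately show ?thesis
    using infinite_super by blast
qed

text \<open>As \<open>cnj w\<close> = 1/w on the circle, \<open>w^4\<close> times the identity says
  that the polynomial \<open>P\<close> has infinitely many roots. Coefficient k of \<open>P\<close>
  has frequency k - 4, and \<open>c\<close> enters only coefficients 3 and 5.\<close>

lemma Z_fun_coeffs:
  assumes "\<forall>w. norm w = 1 \<longrightarrow> w \<noteq> 1 \<longrightarrow> Im (cnj (Z_fun u1 u2 u3 w) * Z_fun v1 v2 v3 w) = c * Re w"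
  shows "u3 * v2 - u2 * v3 = 0" "u3 * v1 - u1 * v3 = 0"
    "u3 * cnj v1 - cnj u1 * v3 + 2 * (u1 * v2 - u2 * v1) = 0"
    "Im (u3 * cnj v3) + 3 * Im (u2 * cnj v2) + 3 * Im (u1 * cnj v1) = 0"
proof -
  define A where "A a1 a2 a3 = [:a3, 2 * a2, 2 * a1, - cnj a1, cnj a2:]" for a1 a2 a3 :: complex
  \<comment> \<open>The coefficients of \<open>A\<close>, reversed and conjugated: on the circle
    this is \<open>w^4\<close> times the conjugate of \<open>Z_fun\<close>.\<close>
  define A' where "A' a1 a2 a3 = [:a2, - a1, 2 * cnj a1, 2 * cnj a2, cnj a3:]" for a1 a2 a3 :: complex
  define P where "P = A u1 u2 u3 * A' v1 v2 v3 - A' u1 u2 u3 * A v1 v2 v3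
    + [:0, 0, 0, \<i> * of_real c, 0, \<i> * of_real c:]"
  have "poly P w = 0" if w: "norm w = 1" "w \<noteq> 1" for w
  proof -
    have ww: "cnj w * w = 1"
      using w by (simp add: complex_norm_square[symmetric] mult.commute)
    have pA: "poly (A a1 a2 a3) w = Z_fun a1 a2 a3 w" for a1 a2 a3
      by (simp add: A_def Z_fun_def algebra_simps power2_eq_square power3_eq_cube power4_eq_xxxx)
    have pA': "poly (A' a1 a2 a3) w = w^4 * cnj (Z_fun a1 a2 a3 w)" for a1 a2 a3
    proof -
      have "w^4 * cnj (Z_fun a1 a2 a3 w) = w^4 * cnj a3 + 2 * (cnj w * w) * w^3 * cnj a2
          + 2 * (cnj w * w)^2 * w^2 * cnj a1 - (cnj w * w)^3 * w * a1 + (cnj w * w)^4 * a2"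
        by (simp add: Z_fun_def) algebra
      then show ?thesis
        unfolding ww by (simp add: A'_def algebra_simps power2_eq_square power3_eq_cube power4_eq_xxxx)
    qed
    have pc: "poly [:0, 0, 0, \<i> * of_real c, 0, \<i> * of_real c:] w = w^4 * (\<i> * of_real (2 * c * Re w))"
    proof -
      have "w^4 * (\<i> * of_real (2 * c * Re w)) = w^4 * (\<i> * (of_real c * (w + cnj w)))"
        by (simp add: complex_add_cnj mult_ac)
      also have "\<dots> = \<i> * of_real c * (w^5 + w^3 * (cnj w * w))"
        by algebra
      finally show ?thesis
        unfolding ww by (simp add: algebra_simps eval_nat_numeral)
    qed
    have "poly P w = w^4 * (Z_fun u1 u2 u3 w * cnj (Z_fun v1 v2 v3 w) - cnj (Z_fun u1 u2 u3 w) * Z_fun v1 v2 v3 w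
      + \<i> * of_real (2 * c * Re w))"
      unfolding P_def poly_add poly_diff poly_mult pA pA' pc by (simp add: algebra_simps)
    also have "\<dots> = w^4 * (\<i> * of_real (2 * (c * Re w - Im (cnj (Z_fun u1 u2 u3 w) * Z_fun v1 v2 v3 w))))"
      by (simp add: complex_eq_iff algebra_simps)
    finally show ?thesis
      unfolding assms[rule_format, OF w] by simp
  qed
  then have "{w. norm w = 1 \<and> w \<noteq> 1} \<subseteq> {w. poly P w = 0}"
    by auto
  then have "P = 0"
    using infinite_unit_circle_minus_1 infinite_super poly_roots_finite by blast
  then have co: "coeff P k = 0" for k
    by simp
  show "u3 * v2 - u2 * v3 = 0"
    using co[of 0] by (simp add: P_def A_def A'_def mult_ac)
  show "u3 * v1 - u1 * v3 = 0"
    using co[of 1] by (simp add: P_def A_def A'_def mult_ac)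
  have "2 * (u3 * cnj v1 - cnj u1 * v3 + 2 * (u1 * v2 - u2 * v1)) = coeff P 2"
    by (simp add: P_def A_def A'_def numeral_2_eq_2 algebra_simps)
  then show "u3 * cnj v1 - cnj u1 * v3 + 2 * (u1 * v2 - u2 * v1) = 0"
    unfolding co by (metis mult_eq_0_iff zero_neq_numeral)
  have "coeff P 4 = 2 * \<i> * of_real (Im (u3 * cnj v3) + 3 * Im (u2 * cnj v2) + 3 * Im (u1 * cnj v1))"
    by (simp add: P_def A_def A'_def eval_nat_numeral complex_eq_iff algebra_simps)
  then show "Im (u3 * cnj v3) + 3 * Im (u2 * cnj v2) + 3 * Im (u1 * cnj v1) = 0"
    unfolding co by (simp del: of_real_add of_real_mult)
qed

text \<open>The squares differ only in their cross terms, by 2 Re (a cnj b (cnj q - q)) with q = a'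
  cnj b'.\<close>

lemma cmod_diff_cnj_squared:
  "(cmod (a * cnj b' - b * cnj a'))\<^sup>2 = (cmod (a * b' - b * a'))\<^sup>2 + 4 * Im (a * cnj b) * Im (a' * cnj b')"
  by (simp add: cmod_power2) algebra

text \<open>All complex 2 x 2 minors of (u, v) vanish, and so do the
  \<open>Im (ui * cnj vi)\<close>: the former gives complex proportionality, the latter a real
  factor. The number \<open>t\<close> is the real inner product of u and v.\<close>

lemma Z_fun_dependent:
  assumes "\<forall>w. norm w = 1 \<longrightarrow> w \<noteq> 1 \<longrightarrow> Im (cnj (Z_fun u1 u2 u3 w) * Z_fun v1 v2 v3 w) = c * Re w"
  obtains t :: real where 
    "of_real ((cmod u1)\<^sup>2 + (cmod u2)\<^sup>2 + (cmod u3)\<^sup>2) * v1 = of_real t * u1"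
    "of_real ((cmod u1)\<^sup>2 + (cmod u2)\<^sup>2 + (cmod u3)\<^sup>2) * v2 = of_real t * u2"
    "of_real ((cmod u1)\<^sup>2 + (cmod u2)\<^sup>2 + (cmod u3)\<^sup>2) * v3 = of_real t * u3"
proof -
  note co = Z_fun_coeffs[OF assms]
  define x where "x = Im (u1 * cnj v1)"
  define y where "y = Im (u2 * cnj v2)"
  define z where "z = Im (u3 * cnj v3)"
  have e: "u3 * v2 - v3 * u2 = 0" "u3 * v1 - v3 * u1 = 0"
    using co(1,2) by (auto simp: mult.commute)
  have "(cmod (u3 * cnj v1 - v3 * cnj u1))\<^sup>2 = 4 * z * x"
    unfolding cmod_diff_cnj_squared x_def z_def e(2) by simp
  moreover have "(cmod (u3 * cnj v1 - v3 * cnj u1))\<^sup>2 = 4 * (cmod (u1 * v2 - v1 * u2))\<^sup>2"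
  proof -
    have "u3 * cnj v1 - v3 * cnj u1 = - 2 * (u1 * v2 - v1 * u2)"
      using co(3) by algebra
    then have "(cmod (u3 * cnj v1 - v3 * cnj u1))\<^sup>2 = (cmod (- 2))\<^sup>2 * (cmod (u1 * v2 - v1 * u2))\<^sup>2"
      by (simp only: norm_mult power_mult_distrib)
    then show ?thesis by simp
  qed
  moreover have "0 \<le> 4 * z * y"
    using zero_le_power2[of "cmod (u3 * cnj v2 - v3 * cnj u2)"]
    unfolding cmod_diff_cnj_squared y_def z_def e(1) by simp
  moreover have "0 \<le> (cmod (u1 * v2 - v1 * u2))\<^sup>2 + 4 * x * y"
    using zero_le_power2[of "cmod (u1 * cnj v2 - v1 * cnj u2)"]
    unfolding cmod_diff_cnj_squared x_def y_def .
  ultimately have *: "(cmod (u1 * v2 - v1 * u2))\<^sup>2 = z * x" "0 \<le> z * x" "0 \<le> z * y" "0 \<le> z * x + 4 * x * y"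
    using zero_le_power2[of "cmod (u1 * v2 - v1 * u2)"] by linarith+
  have z: "z = - 3 * (x + y)"
    using co(4) by (simp add: x_def y_def z_def)
  \<comment> \<open>The left side is nonnegative by \<open>*\<close> and the right side nonpositive,
    so x + y = 0 and z = 0; the last inequality of \<open>*\<close> then forces x = 0.\<close>
  have "z * x + z * y = - 3 * (x + y)\<^sup>2"
    unfolding z by (simp add: power2_eq_square algebra_simps)
  have xy: "x + y = 0"
  proof -
    have "(x + y)\<^sup>2 \<le> 0" using \<open>z * x + z * y = _\<close> *(2,3) by linarith
    then show ?thesis by simp
  qed
  then have "z = 0" using z by simp
  moreover have "x = 0"
  proof -
    have "y = - x" using xy by simp
    then have "x\<^sup>2 \<le> 0" using *(4) \<open>z = 0\<close> by (simp add: power2_eq_square)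
    then show ?thesis by simp
  qed
  ultimately have 0: "x = 0" "y = 0" "z = 0" using xy by auto
  then have g: "u1 * v2 = v1 * u2" using *(1) by simp
  have real: "v1 * cnj u1 = of_real (Re (v1 * cnj u1))" "v2 * cnj u2 = of_real (Re (v2 * cnj u2))"
    "v3 * cnj u3 = of_real (Re (v3 * cnj u3))"
    using 0 by (auto simp: complex_eq_iff x_def y_def z_def mult.commute)
  have N: "of_real ((cmod u1)\<^sup>2 + (cmod u2)\<^sup>2 + (cmod u3)\<^sup>2) = u1 * cnj u1 + u2 * cnj u2 + u3 * cnj u3"
    by (simp add: complex_norm_square del: of_real_power)
  have T: "of_real (Re (v1 * cnj u1) + Re (v2 * cnj u2) + Re (v3 * cnj u3)) = v1 * cnj u1 + v2 * cnj u2 + v3 * cnj u3"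
    by (simp only: of_real_add real[symmetric])
  show ?thesis
  proof (rule that[of "Re (v1 * cnj u1) + Re (v2 * cnj u2) + Re (v3 * cnj u3)"]; unfold N T)
    have swap: "a' * c * b = b' * c * a" if "a * b' = b * a'" for a a' b b' c :: complex
    proof -
      have "a' * c * b = c * (b * a')" by (simp add: mult_ac)
      also have "\<dots> = c * (a * b')" using that by simp
      finally show ?thesis by (simp add: mult_ac)
    qed
    have gs: "u1 * v2 = v1 * u2" "u2 * v1 = v2 * u1" "u3 * v1 = v3 * u1" "u1 * v3 = v1 * u3" "u3 * v2 = v3 * u2" "u2 * v3 = v2 * u3"
      using g e by (simp_all add: mult.commute)
    show "(u1 * cnj u1 + u2 * cnj u2 + u3 * cnj u3) * v1 = (v1 * cnj u1 + v2 * cnj u2 + v3 * cnj u3) * u1"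
      by (simp only: distrib_right swap[OF mult.commute[of u1 v1], of "cnj u1"] swap[OF gs(1), of "cnj u2"] swap[OF gs(4), of "cnj u3"])
    show "(u1 * cnj u1 + u2 * cnj u2 + u3 * cnj u3) * v2 = (v1 * cnj u1 + v2 * cnj u2 + v3 * cnj u3) * u2"
      by (simp only: distrib_right swap[OF mult.commute[of u2 v2], of "cnj u2"] swap[OF gs(2), of "cnj u1"] swap[OF gs(6), of "cnj u3"])
    show "(u1 * cnj u1 + u2 * cnj u2 + u3 * cnj u3) * v3 = (v1 * cnj u1 + v2 * cnj u2 + v3 * cnj u3) * u3"
      by (simp only: distrib_right swap[OF mult.commute[of u3 v3], of "cnj u3"] swap[OF gs(3), of "cnj u1"] swap[OF gs(5), of "cnj u2"])
  qed
qed

subsection \<open>The base system\<close>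

lemma exhaust_8: "i = 0 \<or> i = 1 \<or> i = 2 \<or> i = 3 \<or> i = 4 \<or> i = 5 \<or> i = 6 \<or> i = 7" for i :: 8
proof (induct i)
  case (of_int z)
  then have "z = 0 \<or> z = 1 \<or> z = 2 \<or> z = 3 \<or> z = 4 \<or> z = 5 \<or> z = 6 \<or> z = 7" by fastforce
  then show ?case by auto
qed

lemma forall_8: "(\<forall>i::8. P i) \<longleftrightarrow> P 0 \<and> P 1 \<and> P 2 \<and> P 3 \<and> P 4 \<and> P 5 \<and> P 6 \<and> P 7"
  by (metis exhaust_8)

text \<open>With \<open>\<real>\<^sup>8 = \<complex>\<^sup>4\<close>, where \<open>x$0 + \<i> x$1\<close> is the first complex coordinate (index \<open>0\<close> is the
  same as \<open>8\<close>), \<open>A0\<close> is \<open>-\<i> - 2\<i>N\<close> with \<open>N\<close> the nilpotent shift; the transfer function is then a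
  polynomial in \<open>-2\<i> / (s + \<i>) = w - 1\<close>.\<close>
definition A0_fun :: "real^8 \<Rightarrow> real^8" where
  "A0_fun x = (\<chi> i.
     if i = 0 then x$1 + 2 * x$3 else if i = 1 then - x$0 - 2 * x$2
     else if i = 2 then x$3 + 2 * x$5 else if i = 3 then - x$2 - 2 * x$4
     else if i = 4 then x$5 + 2 * x$7 else if i = 5 then - x$4 - 2 * x$6
     else if i = 6 then x$7 else - x$6)"

definition A0 :: "real^8^8" where "A0 = matrix A0_fun"

lemma A0_mult: "A0 *v x = A0_fun x"
  unfolding A0_def
  by (rule fun_cong[OF matrix_vector_mul(2)]) (auto intro!: linearI simp: A0_fun_def vec_eq_iff algebra_simps)

definition conj8_fun :: "real^8 \<Rightarrow> real^8" where
  "conj8_fun x = (\<chi> i. if i \<in> {0, 2, 4, 6} then x$i else - x$i)"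

definition conj8 :: "real^8^8" where "conj8 = matrix conj8_fun"

lemma conj8_mult: "conj8 *v x = conj8_fun x"
  unfolding conj8_def
  by (rule fun_cong[OF matrix_vector_mul(2)]) (auto intro!: linearI simp: conj8_fun_def vec_eq_iff algebra_simps)

lemma mat_mult_vec: "(mat s :: real^'n^'n) *v x = s *\<^sub>R x"
  by (simp add: mat_def matrix_vector_mult_def vec_eq_iff if_distrib[of "\<lambda>t. t * _"] cong: if_cong)

text \<open>Conjugation by \<open>conj8\<close> turns \<open>s + \<i> + 2\<i>N\<close> into \<open>s - \<i> - 2\<i>N\<close>. The product
  \<open>s\<^sup>2 + (1 + 2N)\<^sup>2\<close> has real coefficients, so it is triangular as a real matrix, and its
  determinant is the square of the wanted one.\<close>
definition conj_product :: "real \<Rightarrow> real^8^8" where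
  "conj_product s = (mat s - A0) ** (conj8 ** (mat s - A0) ** conj8)"

lemma conj_product_mult: "conj_product s *v x = (\<chi> i. (s\<^sup>2 + 1) * x$i +
     (if i = 0 then 4 * x$2 + 4 * x$4 else if i = 1 then 4 * x$3 + 4 * x$5
     else if i = 2 then 4 * x$4 + 4 * x$6 else if i = 3 then 4 * x$5 + 4 * x$7
     else if i = 4 then 4 * x$6 else if i = 5 then 4 * x$7 else 0))"
proof -
  have "conj_product s *v x = (mat s - A0) *v (conj8 *v ((mat s - A0) *v (conj8 *v x)))"
    by (simp add: conj_product_def matrix_vector_mul_assoc matrix_mul_assoc)
  then show ?thesis
    unfolding vec_eq_iff forall_8
    by (simp add: matrix_vector_mult_diff_rdistrib mat_mult_vec A0_mult conj8_mult conj8_fun_def A0_fun_def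
      power2_eq_square algebra_simps)
qed

lemma det_conj_product: "det (conj_product s) = (s\<^sup>2 + 1) ^ 8"
proof -
  have entry: "conj_product s $ i $ j = (conj_product s *v axis j 1) $ i" for i j
    by (simp add: matrix_vector_mult_basis column_def)
  have "\<forall>j i. j < i \<longrightarrow> conj_product s $ i $ j = 0"
    unfolding forall_8 entry conj_product_mult
    by (simp add: less_bit0_def bit0.Rep_numeral bit0.Rep_0 bit0.Rep_1 axis_def)
  moreover have "\<forall>i. conj_product s $ i $ i = s\<^sup>2 + 1"
    unfolding forall_8 entry conj_product_mult by (simp add: axis_def)
  ultimately show ?thesis
    using det_upperdiagonal[of "conj_product s"] by simp
qed

lemma det_conj8: "det conj8 * det conj8 = 1"
proof -
  have "(conj8 ** conj8) *v x = mat 1 *v x" for x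
    unfolding matrix_vector_mul_assoc[symmetric] by (simp add: conj8_mult conj8_fun_def vec_eq_iff)
  then have "conj8 ** conj8 = mat 1"
    unfolding matrix_eq by blast
  then show ?thesis
    by (metis det_I det_mul)
qed

text \<open>The squares agree, which leaves a sign; monicity fixes it.\<close>

lemma char_polynomial_A0: "char_polynomial A0 = [:1, 0, 1:] ^ 4"
proof -
  let ?d = "char_polynomial A0" and ?e = "[:1, 0, 1:] ^ 4 :: real poly"
  have "poly (?d\<^sup>2) s = poly (?e\<^sup>2) s" for s
  proof -
    have "det (conj_product s) = (det (mat s - A0))\<^sup>2"
      using det_conj8 by (simp add: conj_product_def det_mul power2_eq_square)
    then show ?thesis
      by (simp add: poly_char_polynomial det_conj_product power2_eq_square add.commute flip: power_mult)
  qed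
  then have "?d\<^sup>2 = ?e\<^sup>2"
    by (simp add: poly_eq_poly_eq_iff[symmetric] fun_eq_iff)
  then consider "?d = ?e" | "?d = - ?e"
    using power2_eq_iff by blast
  then show ?thesis
  proof cases
    case 2
    then have "lead_coeff ?d = - lead_coeff ?e" by (metis lead_coeff_minus)
    also have "lead_coeff ?e = 1" by (simp add: lead_coeff_power)
    finally show ?thesis
      using char_polynomial_monic[of A0] by (simp add: monic_polys_def)
  qed
qed

text \<open>With \<open>u1 = k$1 + \<i> k$2\<close> and \<open>u2 = k$3 + \<i> k$4\<close>, the required transfer function sends \<open>k\<close> to
  \<open>- 2 (w - 1) u2 - (w^4 - 1) cnj u2 - 2 (w\<^sup>2 - 1) u1 + (w\<^sup>3 - 1) cnj u1\<close>. The complex coordinates of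
  \<open>B0_fun k\<close> are \<open>-2\<i>\<close> times its coefficients as a polynomial in \<open>w - 1\<close>.\<close>
definition B0_fun :: "real^4 \<Rightarrow> real^8" where
  "B0_fun k = (\<chi> i.
     if i = 0 then - 14 * k$2 + 4 * k$4 else if i = 1 then 2 * k$1 + 12 * k$3
     else if i = 2 then - 10 * k$2 + 12 * k$4 else if i = 3 then - 2 * k$1 + 12 * k$3
     else if i = 4 then - 2 * k$2 + 8 * k$4 else if i = 5 then - 2 * k$1 + 8 * k$3
     else if i = 6 then 2 * k$4 else 2 * k$3)"

definition B0 :: "real^4^8" where "B0 = matrix B0_fun"

lemma B0_mult: "B0 *v k = B0_fun k"
  unfolding B0_def
  by (rule fun_cong[OF matrix_vector_mul(2)]) (auto intro!: linearI simp: B0_fun_def vec_eq_iff algebra_simps)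

definition C0_fun :: "real^8 \<Rightarrow> real^2" where
  "C0_fun x = (\<chi> i. if i = 1 then x$0 else x$1)"

definition C0 :: "real^8^2" where "C0 = matrix C0_fun"

lemma C0_mult: "C0 *v x = C0_fun x"
  unfolding C0_def
  by (rule fun_cong[OF matrix_vector_mul(2)]) (auto intro!: linearI simp: C0_fun_def vec_eq_iff algebra_simps)

definition zcoord1 :: "(real^2) \<times> (real^4) \<Rightarrow> complex" where
  "zcoord1 z = Complex (snd z $ 1) (snd z $ 2)"

definition zcoord2 :: "(real^2) \<times> (real^4) \<Rightarrow> complex" where
  "zcoord2 z = Complex (snd z $ 3) (snd z $ 4)"

text \<open>At w = 1, that is s = \<infinity>, the residual of z = (y, k) is y. Setting
  \<open>Z_fun\<close> at w = 1 equal to y and solving for its third coefficient gives this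
  formula.\<close>

definition zcoord3 :: "(real^2) \<times> (real^4) \<Rightarrow> complex" where
  "zcoord3 z = Complex (fst z $ 1) (fst z $ 2) - 2 * zcoord1 z + cnj (zcoord1 z) - 2 * zcoord2 z - cnj (zcoord2 z)"

lemma det_A0: "det (mat s - A0) = (s\<^sup>2 + 1) ^ 4"
  by (simp add: char_polynomial_A0 power2_eq_square add.commute flip: poly_char_polynomial)

lemma det_A0_nz: "det (mat s - A0) \<noteq> 0"
proof -
  have "s\<^sup>2 + 1 > 0" by (simp add: add_nonneg_pos)
  then show ?thesis by (simp add: det_A0)
qed

text \<open>The state equation is triangular in complex coordinates; back substitution gives
  \<open>X1\<close> as a polynomial in d = w - 1 without constant term.\<close>

lemma residual_base:
  fixes s :: real
  defines "w \<equiv> (of_real s - \<i>) / (of_real s + \<i>)"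
  shows "Complex (residual A0 B0 C0 s z $ 1) (residual A0 B0 C0 s z $ 2) = Z_fun (zcoord1 z) (zcoord2 z) (zcoord3 z) w"
proof -
  define x where "x = state A0 B0 s (snd z)"
  define X1 where "X1 = Complex (x$0) (x$1)"
  define X2 where "X2 = Complex (x$2) (x$3)"
  define X3 where "X3 = Complex (x$4) (x$5)"
  define X4 where "X4 = Complex (x$6) (x$7)"
  define d where "d = - 2 * \<i> / (of_real s + \<i>)"
  have nz: "of_real s + \<i> \<noteq> (0::complex)" by (simp add: complex_eq_iff)
  have "(mat s - A0) *v x = B0 *v snd z"
    using state_eq_iff[OF det_A0_nz] x_def by blast
  then have "s *\<^sub>R x - A0_fun x = B0_fun (snd z)"
    by (simp add: matrix_vector_mult_diff_rdistrib mat_mult_vec A0_mult B0_mult)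
  then have eqs: "s * x$i - A0_fun x $ i = B0_fun (snd z) $ i" for i
    by (simp add: vec_eq_iff)
  \<comment> \<open>The complex coordinates of \<open>B0_fun (snd z)\<close> divided by -2i; up to
    sign, the Taylor coefficients of \<open>Z_fun\<close> at w = 1.\<close>
  let ?b1 = "- (2 * zcoord2 z + 4 * cnj (zcoord2 z) + 4 * zcoord1 z - 3 * cnj (zcoord1 z))"
  let ?b2 = "- (6 * cnj (zcoord2 z) + 2 * zcoord1 z - 3 * cnj (zcoord1 z))"
  let ?b3 = "- (4 * cnj (zcoord2 z) - cnj (zcoord1 z))"
  let ?b4 = "- cnj (zcoord2 z)"
  have step: "X = d * Y" if "(of_real s + \<i>) * X = - 2 * \<i> * Y" for X Y
    using that nz by (simp add: d_def field_simps)
  have X: "X4 = d * ?b4" "X3 = d * (X4 + ?b3)" "X2 = d * (X3 + ?b2)" "X1 = d * (X2 + ?b1)"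
    by (rule step; insert eqs[of 0] eqs[of 1] eqs[of 2] eqs[of 3] eqs[of 4] eqs[of 5] eqs[of 6] eqs[of 7];
      simp add: complex_eq_iff X1_def X2_def X3_def X4_def A0_fun_def B0_fun_def zcoord1_def zcoord2_def algebra_simps)+
  have w: "w = 1 + d"
    using nz by (simp add: w_def d_def field_simps)
  have "Complex (fst z $ 1) (fst z $ 2) = zcoord3 z + 2 * zcoord1 z - cnj (zcoord1 z) + 2 * zcoord2 z + cnj (zcoord2 z)"
    by (simp add: zcoord3_def)
  then have "Complex (fst z $ 1) (fst z $ 2) - X1 = Z_fun (zcoord1 z) (zcoord2 z) (zcoord3 z) w"
    unfolding Z_fun_def w X by algebra
  moreover have "Complex (residual A0 B0 C0 s z $ 1) (residual A0 B0 C0 s z $ 2) = Complex (fst z $ 1) (fst z $ 2) - X1"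
    by (simp add: residual_def C0_mult C0_fun_def X1_def complex_eq_iff flip: x_def)
  ultimately show ?thesis by simp
qed

section \<open>Exclusion of every real 2-plane for the base system\<close>

lemma unit_circle_cayley:
  assumes "norm w = 1" "w \<noteq> 1"
  obtains s :: real where "w = (of_real s - \<i>) / (of_real s + \<i>)" "Re w * (s\<^sup>2 + 1) = s\<^sup>2 - 1"
proof -
  define a b where "a = Re w" and "b = Im w"
  have ab: "b\<^sup>2 = (1 - a) * (1 + a)"
    using assms(1) cmod_power2[of w] by (simp add: a_def b_def power2_eq_square algebra_simps)
  have a: "1 - a \<noteq> 0"
  proof
    assume "1 - a = 0"
    then have "a = 1" "b = 0" using ab by auto
    then show False using assms(2) by (simp add: complex_eq_iff a_def b_def)
  qed
  \<comment> \<open>The inverse Cayley transform i(1 + w)/(1 - w), simplified on the unit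
    circle.\<close>
  define s where "s = - b / (1 - a)"
  have s: "s * (1 - a) = - b" using a by (simp add: s_def)
  have bs: "b * s = - (1 + a)"
    using ab a by (simp add: s_def field_simps power2_eq_square)
  have nz: "of_real s + \<i> \<noteq> (0::complex)" by (simp add: complex_eq_iff)
  have "w * (of_real s + \<i>) = of_real s - \<i>"
    using s bs by (simp add: complex_eq_iff a_def b_def algebra_simps)
  moreover have "a * (s\<^sup>2 + 1) = s\<^sup>2 - 1"
    using s bs by algebra
  ultimately show ?thesis
    using nz by (intro that[of s]) (simp_all add: field_simps a_def)
qed

text \<open>Division by (s^2 + 1)^4 gives the Fourier equation, for any \<open>c\<close>, zero
  included. It yields N v = t u; pairing with \<open>v\<close> gives N = 0, hence u = 0.\<close>

lemma base_no_solution: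
  assumes "norm u = 1" "norm v = 1" "u \<bullet> v = 0"
    and eq: "\<And>s. det (mat s - A0) * cross2 (residual A0 B0 C0 s u) (residual A0 B0 C0 s v)
       = c * poly ([:1, 0, 1:] ^ 3 * [:-1, 0, 1:]) s"
  shows False
proof -
  let ?Z = "\<lambda>z. Z_fun (zcoord1 z) (zcoord2 z) (zcoord3 z)"
  have "Im (cnj (?Z u w) * ?Z v w) = c * Re w" if w: "norm w = 1" "w \<noteq> 1" for w
  proof -
    obtain s where s: "w = (of_real s - \<i>) / (of_real s + \<i>)" "Re w * (s\<^sup>2 + 1) = s\<^sup>2 - 1"
      using unit_circle_cayley[OF w] .
    let ?q = "s\<^sup>2 + 1"
    have q: "?q \<noteq> 0" using zero_le_power2[of s] by linarith
    have pq: "poly [:1, 0, 1:] s = ?q" "poly [:-1, 0, 1:] s = s\<^sup>2 - 1"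
      by (simp_all add: power2_eq_square)
    have "Im (cnj (?Z u w) * ?Z v w) = cross2 (residual A0 B0 C0 s u) (residual A0 B0 C0 s v)"
      unfolding s(1) residual_base[symmetric] by (simp add: cross2_def)
    moreover have "?q ^ 4 * cross2 (residual A0 B0 C0 s u) (residual A0 B0 C0 s v) = c * (?q ^ 3 * (s\<^sup>2 - 1))"
      using eq[of s] unfolding det_A0 poly_mult poly_power pq .
    then have "?q ^ 4 * cross2 (residual A0 B0 C0 s u) (residual A0 B0 C0 s v) = ?q ^ 4 * (c * Re w)"
      unfolding s(2)[symmetric] by (simp add: power_numeral_reduce)
    ultimately show ?thesis using q by simp
  qed
  then have "\<forall>w. norm w = 1 \<longrightarrow> w \<noteq> 1 \<longrightarrow> Im (cnj (?Z u w) * ?Z v w) = c * Re w" by blast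
  from Z_fun_dependent[OF this] obtain t where t:
    "of_real ((cmod (zcoord1 u))\<^sup>2 + (cmod (zcoord2 u))\<^sup>2 + (cmod (zcoord3 u))\<^sup>2) * zcoord1 v = of_real t * zcoord1 u"
    "of_real ((cmod (zcoord1 u))\<^sup>2 + (cmod (zcoord2 u))\<^sup>2 + (cmod (zcoord3 u))\<^sup>2) * zcoord2 v = of_real t * zcoord2 u"
    "of_real ((cmod (zcoord1 u))\<^sup>2 + (cmod (zcoord2 u))\<^sup>2 + (cmod (zcoord3 u))\<^sup>2) * zcoord3 v = of_real t * zcoord3 u" .
  define N where "N = (cmod (zcoord1 u))\<^sup>2 + (cmod (zcoord2 u))\<^sup>2 + (cmod (zcoord3 u))\<^sup>2"
  note t' = t[folded N_def]
  have inj: "z = 0" if "zcoord1 z = 0" "zcoord2 z = 0" "zcoord3 z = 0" for z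
    using that by (auto simp: zcoord1_def zcoord2_def zcoord3_def complex_eq_iff prod_eq_iff vec_eq_iff forall_2 forall_4)
  have "zcoord1 (N *\<^sub>R v - t *\<^sub>R u) = of_real N * zcoord1 v - of_real t * zcoord1 u"
    "zcoord2 (N *\<^sub>R v - t *\<^sub>R u) = of_real N * zcoord2 v - of_real t * zcoord2 u"
    "zcoord3 (N *\<^sub>R v - t *\<^sub>R u) = of_real N * zcoord3 v - of_real t * zcoord3 u"
    by (simp_all add: zcoord1_def zcoord2_def zcoord3_def complex_eq_iff algebra_simps)
  with t' have "N *\<^sub>R v - t *\<^sub>R u = 0"
    by (intro inj) simp_all
  then have "(N *\<^sub>R v - t *\<^sub>R u) \<bullet> v = 0" by simp
  moreover have "v \<bullet> v = 1" using assms(2) by (simp add: dot_square_norm)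
  ultimately have "N = 0" using assms(3) by (simp add: inner_diff_left)
  then have "zcoord1 u = 0" "zcoord2 u = 0" "zcoord3 u = 0"
    by (auto simp: N_def add_nonneg_eq_0_iff)
  then show False using inj[of u] assms(1) by simp
qed

theorem mainTheorem3:
  shows "\<not> generic {(A :: real^8^8, B :: real^4^8, C :: real^8^2).
           range (\<lambda>K :: real^2^4. pole_placement A B C K) = monic_polys 8}"
proof -
  define G :: "((real^8^8) \<times> (real^4^8) \<times> (real^8^2)) set" where
    "G = {(A, B, C). range (\<lambda>K :: real^2^4. pole_placement A B C K) = monic_polys 8}"
  define p :: "real poly" where "p = [:1, 0, 1:] ^ 3 * [:-1, 0, 1:]"
  have "p \<in> monic_polys 8"
  proof -
    have "p = [:-1, 0, -2, 0, 0, 0, 2, 0, 1:]"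
      by (simp add: p_def power3_eq_cube)
    then show ?thesis
      by (simp add: monic_polys_def)
  qed
  \<comment> \<open>Otherwise points of \<open>G\<close> converge to the base system. Each has a
    gain realizing \<open>p\<close>, and the limit frame contradicts
    \<open>base_no_solution\<close>.\<close>
  have "\<exists>e>0. ball (A0, B0, C0) e \<inter> G = {}"
  proof (rule ccontr)
    assume "\<not> ?thesis"
    then have "\<exists>x. x \<in> ball (A0, B0, C0) (1 / real (Suc n)) \<inter> G" for n
      by (metis equals0I zero_less_divide_1_iff of_nat_0_less_iff zero_less_Suc)
    then obtain f where f: "\<And>n. f n \<in> ball (A0, B0, C0) (1 / real (Suc n))" "\<And>n. f n \<in> G"
      by (metis IntE)
    have "f \<longlonglongrightarrow> (A0, B0, C0)"
    proof (rule metric_LIMSEQ_I)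
      fix r :: real assume "r > 0"
      then obtain m where m: "1 / real (Suc m) < r" using nat_approx_posE by blast
      have "dist (f n) (A0, B0, C0) < r" if "n \<ge> m" for n
      proof -
        have "1 / real (Suc n) \<le> 1 / real (Suc m)" using that by (simp add: frac_le)
        then show ?thesis using f(1)[of n] m by (simp add: dist_commute)
      qed
      then show "\<exists>m. \<forall>n\<ge>m. dist (f n) (A0, B0, C0) < r" by blast
    qed
    define A B C where "A n = fst (f n)" and "B n = fst (snd (f n))" and "C n = snd (snd (f n))" for n
    have lim: "A \<longlonglongrightarrow> A0" "B \<longlonglongrightarrow> B0" "C \<longlonglongrightarrow> C0"
      using tendsto_fst[OF \<open>f \<longlonglongrightarrow> _\<close>] tendsto_fst[OF tendsto_snd[OF \<open>f \<longlonglongrightarrow> _\<close>]]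
        tendsto_snd[OF tendsto_snd[OF \<open>f \<longlonglongrightarrow> _\<close>]]
      by (simp_all add: A_def[abs_def] B_def[abs_def] C_def[abs_def])
    have "\<exists>K. pole_placement (A n) (B n) (C n) K = p" for n
    proof -
      have "range (\<lambda>K :: real^2^4. pole_placement (A n) (B n) (C n) K) = monic_polys 8"
        using f(2)[of n] by (cases "f n") (simp add: G_def A_def B_def C_def)
      with \<open>p \<in> _\<close> show ?thesis by (metis rangeE)
    qed
    then obtain K where K: "\<And>n. pole_placement (A n) (B n) (C n) (K n) = p" by metis
    obtain u v c where "norm u = 1" "norm v = 1" "u \<bullet> v = 0"
      "\<And>s. det (mat s - A0) \<noteq> 0 \<Longrightarrow> det (mat s - A0) * cross2 (residual A0 B0 C0 s u) (residual A0 B0 C0 s v)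
       = c * poly p s"
      using residual_equation_of_limit[OF lim K] by blast
    then show False
      using base_no_solution[of u v c] det_A0_nz by (simp add: p_def)
  qed
  then have "\<not> generic G"
    using not_generic_if_interior_compl by blast
  then show ?thesis unfolding G_def .
qed

end
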